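(* Let $f:\mathbb{Z}^n\to\mathbb{R}^{p,q}$ be a net in a quadric of $\mathbb{R}^{p,q}$ (with non-vanishing diagonals). Then $f$ is a Moutard net if and only if the edge based net defined by $p^i=f_if$ (Clifford product) is a parallelogram net in the Clifford algebra $Cl_{p,q}(\mathbb{R})$.
   Context: For maps on $\mathbb{Z}^n$ write $f=f(x)$, $f_i=f(x+e_i)$, $f_{ij}=f(x+e_i+e_j)$ (here $e_i$ are unit vectors of $\mathbb{Z}^n$), and for edge based maps $p^i=p^i(x)$ (value on the edge from $x$ in direction $i$), $p^i_j=p^i(x+e_j)$. $\mathbb{R}^{p,q}$ is $\mathbb{R}^{p+q}$ with the inner product $\langle x,y\rangle=x_1y_1+\dots+x_py_p-x_{p+1}y_{p+1}-\dots-x_{p+q}y_{p+q}$. A net $f$ is in a quadric if $\langle f,f\rangle=\kappa$ for some global constant $\kappa\in\mathbb{R}$. It is a Moutard net if there are real numbers $a_{ij}$ on the faces of $\mathbb{Z}^n$ such that $f_{ij}-f=a_{ij}(f_j-f_i)$ for all $1\leq i<j\leq n$. Only nets are considered for which neither diagonal $f_{ij}-f$, $f_j-f_i$ of any quadrilateral vanishes. $Cl_{p,q}(\mathbb{R})$ is the algebra generated by the standard basis $e_1,\dots,e_{p+q}$ of $\mathbb{R}^{p,q}$ with relations $e_ie_j=-e_je_i$ ($i\neq j$), $e_i^2=-\langle e_i,e_i\rangle$; thus vectors satisfy $ab+ba=-2\langle a,b\rangle$. A parallelogram net in an associative unit algebra is an edge based map such that on every quad $p^i+p^j_i=p^j+p^i_j$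 and $p^j_ip^i=p^i_jp^j$. *)

theory Defs
  imports Complex_Main "HOL-Library.FuncSet" "HOL-Algebra.QuotRing"
begin

section \<open>Nets on the integer lattice\<close>

text \<open>Points of \<open>\<int>\<^sup>n\<close> are functions supported in \<open>{1..n}\<close>; this allows \<open>n\<close>, and likewise \<open>p\<close> and \<open>q\<close>
  below, to be arbitrary natural numbers, zero included.\<close>

definition lattice_pts :: "nat \<Rightarrow> (nat \<Rightarrow> int) set" where
  "lattice_pts n = {x. \<forall>k. k \<notin> {1..n} \<longrightarrow> x k = 0}"

definition shift :: "nat \<Rightarrow> (nat \<Rightarrow> int) \<Rightarrow> (nat \<Rightarrow> int)" where
  "shift i x = x(i := x i + 1)"

definition pseudo_space :: "nat \<Rightarrow> nat \<Rightarrow> (nat \<Rightarrow> real) set" where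
  "pseudo_space p q = {v. \<forall>k. k \<notin> {1..p + q} \<longrightarrow> v k = 0}"

definition pseudo_inner :: "nat \<Rightarrow> nat \<Rightarrow> (nat \<Rightarrow> real) \<Rightarrow> (nat \<Rightarrow> real) \<Rightarrow> real" where
  "pseudo_inner p q v w = (\<Sum>k\<in>{1..p}. v k * w k) - (\<Sum>k\<in>{p+1..p+q}. v k * w k)"

definition unit_vec :: "nat \<Rightarrow> (nat \<Rightarrow> real)" where
  "unit_vec i = (\<lambda>k. if k = i then 1 else 0)"

definition net_in_quadric :: "nat \<Rightarrow> nat \<Rightarrow> nat \<Rightarrow> ((nat \<Rightarrow> int) \<Rightarrow> (nat \<Rightarrow> real)) \<Rightarrow> bool" where
  "net_in_quadric n p q f \<longleftrightarrow> (\<exists>\<kappa>. \<forall>x\<in>lattice_pts n. pseudo_inner p q (f x) (f x) = \<kappa>)"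

definition nonvanishing_diagonals :: "nat \<Rightarrow> ((nat \<Rightarrow> int) \<Rightarrow> (nat \<Rightarrow> real)) \<Rightarrow> bool" where
  "nonvanishing_diagonals n f \<longleftrightarrow>
     (\<forall>x\<in>lattice_pts n. \<forall>i j. 1 \<le> i \<and> i < j \<and> j \<le> n \<longrightarrow>
        f (shift i (shift j x)) - f x \<noteq> (\<lambda>_. 0) \<and> f (shift j x) - f (shift i x) \<noteq> (\<lambda>_. 0))"

definition moutard_net :: "nat \<Rightarrow> ((nat \<Rightarrow> int) \<Rightarrow> (nat \<Rightarrow> real)) \<Rightarrow> bool" where
  "moutard_net n f \<longleftrightarrow>
     (\<exists>a :: nat \<Rightarrow> nat \<Rightarrow> (nat \<Rightarrow> int) \<Rightarrow> real.
        \<forall>x\<in>lattice_pts n. \<forall>i j. 1 \<le> i \<and> i < j \<and> j \<le> n \<longrightarrow>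
          f (shift i (shift j x)) - f x = (\<lambda>k. a i j x * (f (shift j x) - f (shift i x)) k))"

text \<open>An edge based map is encoded by \<open>P i x\<close>, its value on the edge from \<open>x\<close> to \<open>shift i x\<close>.
  Only the underlying unital ring of the algebra enters the definition.\<close>

definition parallelogram_net ::
    "('a, 'm) ring_scheme \<Rightarrow> nat \<Rightarrow> (nat \<Rightarrow> (nat \<Rightarrow> int) \<Rightarrow> 'a) \<Rightarrow> bool" where
  "parallelogram_net A n P \<longleftrightarrow>
     (\<forall>x\<in>lattice_pts n. \<forall>i\<in>{1..n}. P i x \<in> carrier A) \<and>
     (\<forall>x\<in>lattice_pts n. \<forall>i j. 1 \<le> i \<and> i < j \<and> j \<le> n \<longrightarrow>
        P i x \<oplus>\<^bsub>A\<^esub> P j (shift i x) = P j x \<oplus>\<^bsub>A\<^esub> P i (shift j x) \<and>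
        P j (shift i x) \<otimes>\<^bsub>A\<^esub> P i x = P i (shift j x) \<otimes>\<^bsub>A\<^esub> P j x)"


section \<open>The Clifford algebra\<close>

text \<open>The free unital associative real algebra on generators \<open>e\<^sub>1, \<dots>, e\<^sub>m\<close>: finitely supported
  real functions on words over \<open>{1..m}\<close>, multiplied by convolution along concatenation.\<close>

definition word_mult :: "(nat list \<Rightarrow> real) \<Rightarrow> (nat list \<Rightarrow> real) \<Rightarrow> (nat list \<Rightarrow> real)" where
  "word_mult a b = (\<lambda>w. \<Sum>k\<le>length w. a (take k w) * b (drop k w))"

definition word_scalar :: "real \<Rightarrow> (nat list \<Rightarrow> real)" where
  "word_scalar c = (\<lambda>w. if w = [] then c else 0)"

definition free_algebra :: "nat \<Rightarrow> (nat list \<Rightarrow> real) ring" where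
  "free_algebra m =
     \<lparr>carrier = {a. finite {w. a w \<noteq> 0} \<and> (\<forall>w. a w \<noteq> 0 \<longrightarrow> set w \<subseteq> {1..m})},
      mult = word_mult, one = word_scalar 1,
      zero = (\<lambda>_. 0), add = (\<lambda>a b w. a w + b w)\<rparr>"

text \<open>The linear embedding sending the \<open>k\<close>-th standard basis vector to the \<open>k\<close>-th generator.\<close>

definition free_vec :: "(nat \<Rightarrow> real) \<Rightarrow> (nat list \<Rightarrow> real)" where
  "free_vec v = (\<lambda>w. if length w = 1 then v (hd w) else 0)"

definition clifford_relators :: "nat \<Rightarrow> nat \<Rightarrow> (nat list \<Rightarrow> real) set" where
  "clifford_relators p q =
     (let F = free_algebra (p + q); e = (\<lambda>i. free_vec (unit_vec i)) in
        {e i \<otimes>\<^bsub>F\<^esub> e j \<oplus>\<^bsub>F\<^esub> e j \<otimes>\<^bsub>F\<^esub> e i | i j. i \<in> {1..p+q} \<and> j \<in> {1..p+q} \<and> i \<noteq> j} \<union>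
        {e i \<otimes>\<^bsub>F\<^esub> e i \<oplus>\<^bsub>F\<^esub> word_scalar (pseudo_inner p q (unit_vec i) (unit_vec i)) | i. i \<in> {1..p+q}})"

text \<open>A two-sided ideal of the free algebra is automatically a real subspace, since scalars are
  elements of the algebra; so the ring quotient is the algebra quotient.\<close>

definition clifford_ideal :: "nat \<Rightarrow> nat \<Rightarrow> (nat list \<Rightarrow> real) set" where
  "clifford_ideal p q = genideal (free_algebra (p + q)) (clifford_relators p q)"

definition clifford :: "nat \<Rightarrow> nat \<Rightarrow> (nat list \<Rightarrow> real) set ring" where
  "clifford p q = free_algebra (p + q) Quot clifford_ideal p q"

definition clifford_vec :: "nat \<Rightarrow> nat \<Rightarrow> (nat \<Rightarrow> real) \<Rightarrow> (nat list \<Rightarrow> real) set" where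
  "clifford_vec p q v = clifford_ideal p q +>\<^bsub>free_algebra (p + q)\<^esub> free_vec v"


section \<open>Well-definedness\<close>

text \<open>The generated ideal is meaningful only if the free algebra really is a ring: the locale
  \<open>ideal\<close> includes this, and the intersection in \<open>genideal\<close> would otherwise be over the empty family.\<close>

lemma free_algebra_ops [simp]:
  "mult (free_algebra m) = word_mult"
  "one (free_algebra m) = word_scalar 1"
  "zero (free_algebra m) = (\<lambda>_. 0)"
  "add (free_algebra m) = (\<lambda>a b w. a w + b w)"
  by (simp_all add: free_algebra_def)

lemma word_mult_assoc: "word_mult (word_mult a b) c = word_mult a (word_mult b c)"
proof
  fix w :: "nat list"
  have swap: "(\<Sum>k\<le>m. \<Sum>j\<le>k. h j (k - j)) = (\<Sum>j\<le>m. \<Sum>i\<le>m - j. h j i)"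
    for m and h :: "nat \<Rightarrow> nat \<Rightarrow> real"
    by (induction m) (simp_all add: Suc_diff_le sum.distrib add.assoc)
  let ?h = "\<lambda>j i. a (take j w) * b (take i (drop j w)) * c (drop (j + i) w)"
  have "word_mult (word_mult a b) c w = (\<Sum>k\<le>length w. \<Sum>j\<le>k. ?h j (k - j))"
    by (auto simp: word_mult_def sum_distrib_right drop_take min_def intro!: sum.cong)
  also have "\<dots> = (\<Sum>j\<le>length w. \<Sum>i\<le>length w - j. ?h j i)"
    by (rule swap)
  also have "\<dots> = word_mult a (word_mult b c) w"
    by (auto simp: word_mult_def sum_distrib_left mult.assoc add.commute intro!: sum.cong)
  finally show "word_mult (word_mult a b) c w = word_mult a (word_mult b c) w" .
qed

lemma word_mult_scalar_left: "word_mult (word_scalar c) a = (\<lambda>w. c * a w)"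
proof
  fix w :: "nat list"
  have "word_mult (word_scalar c) a w = (\<Sum>k\<le>length w. if k = 0 then c * a w else 0)"
    unfolding word_mult_def word_scalar_def by (rule sum.cong) auto
  then show "word_mult (word_scalar c) a w = c * a w" by simp
qed

lemma word_mult_scalar_right: "word_mult a (word_scalar c) = (\<lambda>w. c * a w)"
proof
  fix w :: "nat list"
  have "word_mult a (word_scalar c) w = (\<Sum>k\<le>length w. if k = length w then c * a w else 0)"
    unfolding word_mult_def word_scalar_def by (rule sum.cong) auto
  then show "word_mult a (word_scalar c) w = c * a w" by simp
qed

lemma word_mult_closed:
  assumes "a \<in> carrier (free_algebra m)" "b \<in> carrier (free_algebra m)"
  shows "word_mult a b \<in> carrier (free_algebra m)"
proof -
  have fact: "\<exists>u v. w = u @ v \<and> a u \<noteq> 0 \<and> b v \<noteq> 0" if "word_mult a b w \<noteq> 0" for w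
  proof -
    obtain k where "a (take k w) * b (drop k w) \<noteq> 0"
      using \<open>word_mult a b w \<noteq> 0\<close> unfolding word_mult_def by (meson sum.not_neutral_contains_not_neutral)
    then show ?thesis by (metis append_take_drop_id mult_eq_0_iff)
  qed
  have "{w. word_mult a b w \<noteq> 0} \<subseteq> (\<lambda>(u, v). u @ v) ` ({w. a w \<noteq> 0} \<times> {w. b w \<noteq> 0})"
    using fact by fastforce
  moreover have "finite ({w. a w \<noteq> 0} \<times> {w. b w \<noteq> 0})"
    using assms by (auto simp: free_algebra_def)
  ultimately have "finite {w. word_mult a b w \<noteq> 0}"
    by (meson finite_imageI finite_subset)
  moreover have "set w \<subseteq> {1..m}" if "word_mult a b w \<noteq> 0" for w
  proof -
    from fact[OF that] obtain u v where "w = u @ v" "a u \<noteq> 0" "b v \<noteq> 0" by blast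
    moreover have "set u \<subseteq> {1..m}" "set v \<subseteq> {1..m}"
      using assms \<open>a u \<noteq> 0\<close> \<open>b v \<noteq> 0\<close> unfolding free_algebra_def by auto
    ultimately show ?thesis by simp
  qed
  ultimately show ?thesis by (auto simp: free_algebra_def)
qed

lemma word_add_closed:
  assumes "a \<in> carrier (free_algebra m)" "b \<in> carrier (free_algebra m)"
  shows "(\<lambda>w. a w + b w) \<in> carrier (free_algebra m)"
proof -
  have "{w. a w + b w \<noteq> 0} \<subseteq> {w. a w \<noteq> 0} \<union> {w. b w \<noteq> 0}" by auto
  then have "finite {w. a w + b w \<noteq> 0}"
    using assms by (auto simp: free_algebra_def intro: finite_subset)
  moreover have "set w \<subseteq> {1..m}" if "a w + b w \<noteq> 0" for w
  proof -
    have "a w \<noteq> 0 \<or> b w \<noteq> 0" using that by auto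
    then show ?thesis using assms unfolding free_algebra_def by auto
  qed
  ultimately show ?thesis by (auto simp: free_algebra_def)
qed

lemma word_scalar_closed: "word_scalar c \<in> carrier (free_algebra m)"
proof -
  have "{w. word_scalar c w \<noteq> 0} \<subseteq> {[]}" by (auto simp: word_scalar_def split: if_splits)
  then show ?thesis
    by (auto simp: free_algebra_def word_scalar_def intro: finite_subset split: if_splits)
qed

lemma ring_free_algebra: "ring (free_algebra m)"
proof (rule ringI)
  show "abelian_group (free_algebra m)"
  proof (rule abelian_groupI)
    fix a assume "a \<in> carrier (free_algebra m)"
    then have "(\<lambda>w. - a w) \<in> carrier (free_algebra m)" by (simp add: free_algebra_def)
    then show "\<exists>b\<in>carrier (free_algebra m). b \<oplus>\<^bsub>free_algebra m\<^esub> a = \<zero>\<^bsub>free_algebra m\<^esub>"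
      by (rule bexI[rotated]) simp
  next
    show "\<zero>\<^bsub>free_algebra m\<^esub> \<in> carrier (free_algebra m)"
      by (simp add: free_algebra_def)
  qed (simp_all add: word_add_closed ac_simps)
  show "Group.monoid (free_algebra m)"
    by (rule monoidI)
      (simp_all add: word_mult_closed word_scalar_closed word_mult_assoc
        word_mult_scalar_left word_mult_scalar_right)
qed (simp_all add: word_mult_def distrib_left distrib_right sum.distrib)

lemma free_vec_closed:
  assumes "v \<in> pseudo_space p q"
  shows "free_vec v \<in> carrier (free_algebra (p + q))"
proof -
  have "{w. free_vec v w \<noteq> 0} \<subseteq> (\<lambda>k. [k]) ` {1..p+q}"
  proof
    fix w assume "w \<in> {w. free_vec v w \<noteq> 0}"
    then obtain k where "w = [k]" "v k \<noteq> 0"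
      by (auto simp: free_vec_def length_Suc_conv split: if_splits)
    then show "w \<in> (\<lambda>k. [k]) ` {1..p+q}" using assms unfolding pseudo_space_def by blast
  qed
  then show ?thesis by (auto simp: free_algebra_def intro: finite_subset)
qed

lemma unit_vec_in: "i \<in> {1..p+q} \<Longrightarrow> unit_vec i \<in> pseudo_space p q"
  by (auto simp: pseudo_space_def unit_vec_def)

lemma clifford_relators_subset: "clifford_relators p q \<subseteq> carrier (free_algebra (p + q))"
proof -
  interpret F: ring "free_algebra (p + q)" by (rule ring_free_algebra)
  have "free_vec (unit_vec i) \<in> carrier (free_algebra (p + q))" if "i \<in> {1..p+q}" for i
    using that free_vec_closed unit_vec_in by blast
  then show ?thesis
    unfolding clifford_relators_def Let_def by (auto simp del: free_algebra_ops intro!: F.a_closed F.m_closed word_scalar_closed)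
qed

lemma ideal_clifford: "ideal (clifford_ideal p q) (free_algebra (p + q))"
  unfolding clifford_ideal_def
  by (rule ring.genideal_ideal[OF ring_free_algebra clifford_relators_subset])

lemma ring_clifford: "ring (clifford p q)"
  unfolding clifford_def by (rule ideal.quotient_is_ring[OF ideal_clifford])

end

theory Submission
  imports Defs
begin

text \<open>Write \<open>d = f\<^sub>j - f\<^sub>i\<close>. The multiplicative condition always holds, since \<open>f\<^sub>i f\<^sub>i = f\<^sub>j f\<^sub>j = -\<kappa>\<close>,
  and the additive one says \<open>d f + f\<^sub>i\<^sub>j d = 0\<close>. If \<open>f\<^sub>i\<^sub>j = f + s d\<close>, the left side is the scalar
  \<open>- (2 \<langle>d, f\<rangle> + s \<langle>d, d\<rangle>)\<close>, which vanishes because \<open>\<langle>f\<^sub>i\<^sub>j, f\<^sub>i\<^sub>j\<rangle> = \<langle>f, f\<rangle>\<close> and \<open>s \<noteq> 0\<close>. Conversely, its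
  bivector part is \<open>(f\<^sub>i\<^sub>j - f) \<and> d\<close>, so \<open>f\<^sub>i\<^sub>j - f\<close> is a multiple of \<open>d \<noteq> 0\<close>. That bivector parts are
  well defined in the quotient is seen from a concrete action of the free algebra on functions of
  index sets, whose kernel contains the Clifford ideal.\<close>

section \<open>Generator operators on functions of index sets\<close>

definition toggle :: "nat \<Rightarrow> nat set \<Rightarrow> nat set" where
  "toggle k A = (if k \<in> A then A - {k} else insert k A)"

text \<open>In the Clifford algebra with \<open>e\<^sub>k\<^sup>2 = e k\<close>, the generator \<open>e\<^sub>k\<close> times the increasing monomial indexed
  by \<open>A\<close> is \<open>gen_sign e k A\<close> times the monomial indexed by \<open>toggle k A\<close>; \<open>gen_op e k\<close> is the transpose
  of this left multiplication.\<close>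

definition gen_sign :: "(nat \<Rightarrow> real) \<Rightarrow> nat \<Rightarrow> nat set \<Rightarrow> real" where
  "gen_sign e k A = (-1) ^ card {l \<in> A. l < k} * (if k \<in> A then e k else 1)"

definition gen_op :: "(nat \<Rightarrow> real) \<Rightarrow> nat \<Rightarrow> (nat set \<Rightarrow> real) \<Rightarrow> nat set \<Rightarrow> real" where
  "gen_op e k g A = gen_sign e k A * g (toggle k A)"

text \<open>A word acts as the composite of its generator operators, its first letter acting last.
  Transposition reverses products, which is harmless because the Clifford relations are invariant
  under reversal. On infinite support the sum would default to 0, hence the finiteness hypotheses
  below.\<close>

definition alg_op :: "(nat \<Rightarrow> real) \<Rightarrow> (nat list \<Rightarrow> real) \<Rightarrow> (nat set \<Rightarrow> real) \<Rightarrow> nat set \<Rightarrow> real" where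
  "alg_op e a g A = (\<Sum>w | a w \<noteq> 0. a w * foldr (gen_op e) w g A)"

lemma toggle_toggle [simp]: "toggle k (toggle k A) = A"
  by (auto simp: toggle_def)

lemma toggle_commute: "toggle k (toggle l A) = toggle l (toggle k A)"
  by (auto simp: toggle_def)

text \<open>Toggling \<open>k\<close> leaves the indices below \<open>k\<close> alone, so the two
  signs cancel; exactly one of \<open>A\<close> and \<open>toggle k A\<close> contains
  \<open>k\<close>, and it contributes \<open>e k\<close> once.\<close>

lemma gen_op_square: "gen_op e k (gen_op e k g) A = e k * g A"
proof -
  have "{l \<in> toggle k A. l < k} = {l \<in> A. l < k}"
    by (auto simp: toggle_def)
  then show ?thesis
    by (simp add: gen_op_def gen_sign_def) (simp add: toggle_def)
qed

lemma gen_sign_toggle_greater: "k < l \<Longrightarrow> gen_sign e k (toggle l A) = gen_sign e k A"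
proof -
  assume "k < l"
  then have "{j \<in> toggle l A. j < k} = {j \<in> A. j < k}" "k \<in> toggle l A \<longleftrightarrow> k \<in> A"
    by (auto simp: toggle_def)
  then show ?thesis by (simp add: gen_sign_def)
qed

text \<open>The smaller index enters or leaves the set counted by the exponent, whose parity
  therefore flips.\<close>

lemma gen_sign_toggle_less:
  assumes "k < l"
  shows "gen_sign e l (toggle k A) = - gen_sign e l A"
proof -
  have *: "gen_sign e l (insert k B) = - gen_sign e l B" if "k \<notin> B" for B
  proof -
    have "{j \<in> insert k B. j < l} = insert k {j \<in> B. j < l}" "l \<in> insert k B \<longleftrightarrow> l \<in> B"
      using assms by auto
    then show ?thesis using that by (simp add: gen_sign_def)
  qed
  show ?thesis
  proof (cases "k \<in> A")
    case True
    \<comment> \<open>Removal is insertion read backwards, so the case of insertion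
      suffices.\<close>
    then have "A = insert k (A - {k})" by auto
    then have "gen_sign e l A = - gen_sign e l (A - {k})" using *[of "A - {k}"] by simp
    then show ?thesis using True by (simp add: toggle_def)
  qed (simp add: toggle_def *)
qed

text \<open>For \<open>k < l\<close>, toggling \<open>l\<close> keeps the sign of \<open>k\<close>
  while toggling \<open>k\<close> flips the sign of \<open>l\<close>, so exchanging the operators
  costs exactly one factor -1.\<close>

lemma gen_op_anticommute:
  assumes "k \<noteq> l"
  shows "gen_op e k (gen_op e l g) A = - gen_op e l (gen_op e k g) A"
proof -
  have "gen_op e k (gen_op e l g) A = - gen_op e l (gen_op e k g) A" if "k < l" for k l
    using that
    by (simp add: gen_op_def gen_sign_toggle_less gen_sign_toggle_greater toggle_commute[of k l])
  from this[of k l] this[of l k] show ?thesis using assms by (cases "k < l") auto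
qed

section \<open>Extension of the action to the free algebra\<close>

lemma foldr_gen_op_sum:
  "foldr (gen_op e) w (\<lambda>A. \<Sum>x\<in>S. c x * h x A) = (\<lambda>A. \<Sum>x\<in>S. c x * foldr (gen_op e) w (h x) A)"
  by (induction w) (auto simp: gen_op_def sum_distrib_left mult_ac)

lemma foldr_gen_op_zero: "foldr (gen_op e) w (\<lambda>A. 0) = (\<lambda>A. 0)"
  by (induction w) (auto simp: gen_op_def)

lemma alg_op_eq_sum:
  assumes "finite S" "{w. a w \<noteq> 0} \<subseteq> S"
  shows "alg_op e a g A = (\<Sum>w\<in>S. a w * foldr (gen_op e) w g A)"
  unfolding alg_op_def using assms by (intro sum.mono_neutral_left) auto

text \<open>Concatenated words act by composition, so convolution of coefficients becomes
  composition of operators.\<close>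

lemma alg_op_word_mult:
  assumes "finite {w. a w \<noteq> 0}" "finite {w. b w \<noteq> 0}"
  shows "alg_op e (word_mult a b) g = alg_op e a (alg_op e b g)"
proof
  fix A
  let ?Sa = "{w. a w \<noteq> 0}" and ?Sb = "{w. b w \<noteq> 0}"
  let ?S = "(\<lambda>(u, v). u @ v) ` (?Sa \<times> ?Sb)"
  let ?r = "\<lambda>w. foldr (gen_op e) w g A"
  let ?T = "SIGMA w:?S. {..length w}"
  have finS: "finite ?S" using assms by simp
  have td: "take (length u) (u @ v) = u" "drop (length u) (u @ v) = v" for u v :: "nat list"
    by simp_all
  have "{w. word_mult a b w \<noteq> 0} \<subseteq> ?S"
  proof
    fix w assume "w \<in> {w. word_mult a b w \<noteq> 0}"
    then obtain k where "a (take k w) * b (drop k w) \<noteq> 0"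
      unfolding word_mult_def by (metis (mono_tags, lifting) mem_Collect_eq sum.not_neutral_contains_not_neutral)
    then have "(take k w, drop k w) \<in> ?Sa \<times> ?Sb" by simp
    then have "(\<lambda>(u, v). u @ v) (take k w, drop k w) \<in> ?S" by (rule imageI)
    then show "w \<in> ?S" by simp
  qed
  then have "alg_op e (word_mult a b) g A = (\<Sum>w\<in>?S. word_mult a b w * ?r w)"
    by (rule alg_op_eq_sum[OF finS])
  also have "\<dots> = (\<Sum>w\<in>?S. \<Sum>k\<le>length w. a (take k w) * b (drop k w) * ?r w)"
    by (simp add: word_mult_def sum_distrib_right)
  also have "\<dots> = (\<Sum>(w, k)\<in>?T. a (take k w) * b (drop k w) * ?r w)"
    using finS by (subst sum.Sigma) auto
  also have "\<dots> = (\<Sum>(w, k)\<in>{(w, k) \<in> ?T. a (take k w) \<noteq> 0 \<and> b (drop k w) \<noteq> 0}.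
      a (take k w) * b (drop k w) * ?r w)"
    using finS by (intro sum.mono_neutral_right) auto
  \<comment> \<open>A cut \<open>(w, k)\<close> with both coefficients nonzero corresponds to its
    prefix and suffix; conversely, \<open>(u, v)\<close> is the word \<open>u @ v\<close> cut at
    \<open>length u\<close>.\<close>
  also have "\<dots> = (\<Sum>(u, v)\<in>?Sa \<times> ?Sb. a u * b v * ?r (u @ v))"
    by (rule sum.reindex_bij_witness[where i = "\<lambda>(u, v). (u @ v, length u)"
          and j = "\<lambda>(w, k). (take k w, drop k w)"]) (auto simp: td simp del: take_append drop_append foldr_append intro: rev_image_eqI)
  also have "\<dots> = (\<Sum>u\<in>?Sa. \<Sum>v\<in>?Sb. a u * b v * ?r (u @ v))"
    by (rule sum.cartesian_product[symmetric])
  also have "\<dots> = (\<Sum>u\<in>?Sa. a u * foldr (gen_op e) u (\<lambda>A. \<Sum>v\<in>?Sb. b v * foldr (gen_op e) v g A) A)"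
    by (simp add: foldr_gen_op_sum sum_distrib_left mult.assoc)
  also have "\<dots> = alg_op e a (alg_op e b g) A"
    unfolding alg_op_def by simp
  finally show "alg_op e (word_mult a b) g A = alg_op e a (alg_op e b g) A" .
qed

lemma alg_op_lin:
  assumes "finite {w. a w \<noteq> 0}" "finite {w. b w \<noteq> 0}"
  shows "alg_op e (\<lambda>w. r * a w + s * b w) g A = r * alg_op e a g A + s * alg_op e b g A"
proof -
  \<comment> \<open>Cancellation can shrink the support of the combination, so all three sums run
    over the union of the supports.\<close>
  let ?S = "{w. a w \<noteq> 0} \<union> {w. b w \<noteq> 0}"
  have fin: "finite ?S" using assms by simp
  have *: "alg_op e c g A = (\<Sum>w\<in>?S. c w * foldr (gen_op e) w g A)" if "{w. c w \<noteq> 0} \<subseteq> ?S" for c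
    using alg_op_eq_sum[OF fin that] .
  have "{w. r * a w + s * b w \<noteq> 0} \<subseteq> ?S" by auto
  from *[of a] *[of b] *[OF this] show ?thesis
    by (simp add: sum_distrib_left sum.distrib algebra_simps)
qed

lemma alg_op_scalar: "alg_op e (word_scalar c) g A = c * g A"
proof -
  have "{w. word_scalar c w \<noteq> 0} \<subseteq> {[]}" by (auto simp: word_scalar_def split: if_splits)
  then show ?thesis by (subst alg_op_eq_sum[of "{[]}"]) (auto simp: word_scalar_def)
qed

text \<open>Any finite \<open>S\<close> containing the support is allowed, so that one index set can
  serve several vectors.\<close>

lemma alg_op_free_vec:
  assumes "finite S" "\<And>k. k \<notin> S \<Longrightarrow> v k = 0"
  shows "alg_op e (free_vec v) g A = (\<Sum>k\<in>S. v k * gen_op e k g A)"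
proof -
  have "{w. free_vec v w \<noteq> 0} \<subseteq> (\<lambda>k. [k]) ` S"
    using assms(2) by (fastforce simp: free_vec_def length_Suc_conv split: if_splits)
  then have "alg_op e (free_vec v) g A = (\<Sum>w\<in>(\<lambda>k. [k]) ` S. free_vec v w * foldr (gen_op e) w g A)"
    using assms(1) by (intro alg_op_eq_sum) auto
  also have "\<dots> = (\<Sum>k\<in>S. v k * gen_op e k g A)"
    by (subst sum.reindex) (auto simp: free_vec_def inj_on_def)
  finally show ?thesis .
qed

lemma alg_op_free_vec_unit: "alg_op e (free_vec (unit_vec k)) = gen_op e k"
  by (intro ext, subst alg_op_free_vec[of "{k}"]) (auto simp: unit_vec_def)

lemma finite_support: "a \<in> carrier (free_algebra m) \<Longrightarrow> finite {w. a w \<noteq> 0}"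
  by (simp add: free_algebra_def)

lemma alg_op_add:
  assumes "a \<in> carrier (free_algebra m)" "b \<in> carrier (free_algebra m)"
  shows "alg_op e (\<lambda>w. a w + b w) g A = alg_op e a g A + alg_op e b g A"
  using alg_op_lin[of a b e 1 1] assms by (simp add: finite_support)

lemma alg_op_diff:
  assumes "finite {w. a w \<noteq> 0}" "finite {w. b w \<noteq> 0}"
  shows "alg_op e (\<lambda>w. a w - b w) g A = alg_op e a g A - alg_op e b g A"
  using alg_op_lin[OF assms, of e 1 "-1"] by simp

lemma alg_op_zero: "alg_op e a (\<lambda>A. 0) = (\<lambda>A. 0)"
  by (auto simp: alg_op_def foldr_gen_op_zero)

section \<open>The Clifford ideal acts by zero\<close>

lemma free_algebra_uminus:
  assumes "a \<in> carrier (free_algebra m)"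
  shows "\<ominus>\<^bsub>free_algebra m\<^esub> a = (\<lambda>w. - a w)"
proof -
  interpret F: ring "free_algebra m" by (rule ring_free_algebra)
  have "(\<lambda>w. - a w) \<in> carrier (free_algebra m)"
    using assms by (simp add: free_algebra_def)
  with assms show ?thesis by (intro F.minus_equality) simp_all
qed

lemma ideal_alg_op_kernel:
  "ideal {a \<in> carrier (free_algebra m). \<forall>g. alg_op e a g = (\<lambda>A. 0)} (free_algebra m)"
    (is "ideal ?K ?F")
proof (rule idealI[OF ring_free_algebra])
  interpret F: ring ?F by (rule ring_free_algebra)
  show "subgroup ?K (add_monoid ?F)"
  proof (rule F.add.subgroupI)
    show "?K \<noteq> {}"
      using F.zero_closed by (auto simp: alg_op_def intro!: exI[of _ "\<lambda>_. 0"])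
  next
    fix a assume a: "a \<in> ?K"
    then have "finite {w. a w \<noteq> 0}" using finite_support by blast
    then have "alg_op e (\<lambda>w. - a w) g A = 0" for g A
      using a alg_op_lin[of a a e "-1" 0 g A] by simp
    then show "\<ominus>\<^bsub>?F\<^esub> a \<in> ?K" using a F.a_inv_closed[of a] by (auto simp: free_algebra_uminus)
  next
    fix a b assume "a \<in> ?K" "b \<in> ?K"
    then show "a \<oplus>\<^bsub>?F\<^esub> b \<in> ?K"
      using F.a_closed[of a b] by (auto simp: alg_op_add)
  qed auto
  fix a x assume "a \<in> ?K" "x \<in> carrier ?F"
  \<comment> \<open>Products with \<open>x\<close> on the left vanish because every operator fixes
    the zero function; those with \<open>x\<close> on the right because the kernel condition ranges
    over all \<open>g\<close>.\<close>
  then show "x \<otimes>\<^bsub>?F\<^esub> a \<in> ?K" "a \<otimes>\<^bsub>?F\<^esub> x \<in> ?K"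
    by (auto simp: alg_op_word_mult finite_support alg_op_zero word_mult_closed)
qed

text \<open>The weights are the prescribed squares of the generators. The relators are then killed
  by \<open>gen_op_anticommute\<close> and \<open>gen_op_square\<close>, and minimality of the
  generated ideal does the rest.\<close>

lemma alg_op_clifford_ideal:
  assumes "a \<in> clifford_ideal p q"
  shows "alg_op (\<lambda>k. - pseudo_inner p q (unit_vec k) (unit_vec k)) a g A = 0"
proof -
  let ?e = "\<lambda>k. - pseudo_inner p q (unit_vec k) (unit_vec k)" and ?F = "free_algebra (p + q)"
  let ?K = "{a \<in> carrier ?F. \<forall>g. alg_op ?e a g = (\<lambda>A. 0)}"
  have vec: "free_vec (unit_vec i) \<in> carrier ?F" if "i \<in> {1..p+q}" for i
    using that free_vec_closed unit_vec_in by blast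
  have "clifford_relators p q \<subseteq> ?K"
  proof
    fix x assume x: "x \<in> clifford_relators p q"
    then consider i j where "i \<in> {1..p+q}" "j \<in> {1..p+q}" "i \<noteq> j"
        "x = (\<lambda>w. word_mult (free_vec (unit_vec i)) (free_vec (unit_vec j)) w
               + word_mult (free_vec (unit_vec j)) (free_vec (unit_vec i)) w)"
      | i where "i \<in> {1..p+q}"
        "x = (\<lambda>w. word_mult (free_vec (unit_vec i)) (free_vec (unit_vec i)) w
               + word_scalar (pseudo_inner p q (unit_vec i) (unit_vec i)) w)"
      unfolding clifford_relators_def Let_def by auto
    then have "alg_op ?e x g A = 0" for g A
    proof cases
      case (1 i j)
      note c = vec[OF 1(1)] vec[OF 1(2)]
      show ?thesis
        unfolding 1(4) alg_op_add[OF word_mult_closed[OF c] word_mult_closed[OF c(2) c(1)]]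
        using 1(3) by (simp add: alg_op_word_mult finite_support[OF c(1)] finite_support[OF c(2)]
            alg_op_free_vec_unit gen_op_anticommute[of i j])
    next
      case (2 i)
      note c = vec[OF 2(1)]
      show ?thesis
        unfolding 2(2) alg_op_add[OF word_mult_closed[OF c c] word_scalar_closed]
        by (simp add: alg_op_word_mult finite_support[OF c] alg_op_free_vec_unit gen_op_square
            alg_op_scalar)
    qed
    then show "x \<in> ?K" using subsetD[OF clifford_relators_subset x] by auto
  qed
  then have "clifford_ideal p q \<subseteq> ?K"
    unfolding clifford_ideal_def
    by (rule ring.genideal_minimal[OF ring_free_algebra ideal_alg_op_kernel])
  with assms show ?thesis by auto
qed


section \<open>Bivector coefficients of products of vectors\<close>

text \<open>Testing at the empty set against the indicator of \<open>{k, l}\<close> reads off the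
  coefficient of that bivector. The sign is opposite to the usual one since the transposed operators
  compose in reverse order.\<close>

lemma alg_op_wedge:
  assumes "a \<in> pseudo_space p q" "b \<in> pseudo_space p q" "k < l"
  shows "alg_op e (word_mult (free_vec a) (free_vec b)) (\<lambda>A. if A = {k, l} then 1 else 0) {}
    = a l * b k - a k * b l"
proof -
  let ?g = "\<lambda>A. if A = {k, l} then 1 else (0::real)"
  \<comment> \<open>\<open>k\<close> and \<open>l\<close> may lie outside \<open>{1..p+q}\<close>;
    adding them lets both delta sums below collapse without cases.\<close>
  let ?S = "{1..p+q} \<union> {k, l}"
  have v: "alg_op e (free_vec c) g A = (\<Sum>k\<in>?S. c k * gen_op e k g A)"
    if "c \<in> pseudo_space p q" for c g A
    using that by (intro alg_op_free_vec) (auto simp: pseudo_space_def)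
  have "gen_op e i (gen_op e j ?g) {} = (if i = l \<and> j = k then 1 else 0) - (if i = k \<and> j = l then 1 else 0)"
    for i j
  proof (cases "i = j")
    case True
    then show ?thesis using \<open>k < l\<close> by (auto simp: gen_op_square)
  next
    case False
    \<comment> \<open>This is the set counted by the exponent in \<open>gen_sign e j {i}\<close>: a
      minus sign arises exactly when \<open>i < j\<close>.\<close>
    have "{m. m = i \<and> m < j} = (if i < j then {i} else {})" by auto
    then show ?thesis using False \<open>k < l\<close>
      by (auto simp: gen_op_def gen_sign_def toggle_def doubleton_eq_iff)
  qed
  note pair = this
  have fin: "finite {w. free_vec c w \<noteq> 0}" if "c \<in> pseudo_space p q" for c
    using free_vec_closed[OF that] by (rule finite_support)
  have "alg_op e (word_mult (free_vec a) (free_vec b)) ?g {}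
    = (\<Sum>i\<in>?S. a i * gen_op e i (alg_op e (free_vec b) ?g) {})"
    using assms by (simp only: alg_op_word_mult fin v)
  also have "\<dots> = (\<Sum>i\<in>?S. \<Sum>j\<in>?S. a i * b j * gen_op e i (gen_op e j ?g) {})"
    unfolding gen_op_def[of e _ "alg_op e (free_vec b) ?g"] v[OF assms(2)]
    unfolding gen_op_def[of e _ "gen_op e _ _"]
    by (simp only: sum_distrib_left mult_ac)
  also have "\<dots> = (\<Sum>i\<in>?S. \<Sum>j\<in>?S. (if i = l then (if j = k then a i * b j else 0) else 0)
      - (if i = k then (if j = l then a i * b j else 0) else 0))"
    unfolding pair by (intro sum.cong refl) auto
  also have "\<dots> = (\<Sum>i\<in>?S. (if i = l then a i * b k else 0) - (if i = k then a i * b l else 0))"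
    by (intro sum.cong refl) (auto simp: sum_subtractf)
  also have "\<dots> = a l * b k - a k * b l"
    by (simp add: sum_subtractf)
  finally show ?thesis .
qed

lemma parallel_if_wedge_zero:
  fixes s d :: "nat \<Rightarrow> real"
  assumes "\<And>k l. k < l \<Longrightarrow> s l * d k = s k * d l" "d \<noteq> (\<lambda>_. 0)" 
  shows "\<exists>c. s = (\<lambda>k. c * d k)"
proof -
  \<comment> \<open>The ratio is fixed by one nonzero coordinate:
    \<open>c = s m / d m\<close>.\<close>
  obtain m where m: "d m \<noteq> 0" using assms(2) by auto
  have "s k * d m = s m * d k" for k
    using assms(1)[of k m] assms(1)[of m k] by (cases k m rule: linorder_cases) auto
  then have "s k = s m / d m * d k" for k
    using m by (simp add: field_simps)
  then show ?thesis by blast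
qed


section \<open>The relation between arbitrary vectors\<close>

text \<open>The representative of \<open>ab + ba + 2<a,b>\<close> in the free algebra; its
  membership in the ideal is the polarized Clifford relation.\<close>

definition clifford_rel ::
    "nat \<Rightarrow> nat \<Rightarrow> (nat \<Rightarrow> real) \<Rightarrow> (nat \<Rightarrow> real) \<Rightarrow> nat list \<Rightarrow> real" where
  "clifford_rel p q a b = (\<lambda>w. word_mult (free_vec a) (free_vec b) w
     + word_mult (free_vec b) (free_vec a) w + word_scalar (2 * pseudo_inner p q a b) w)"

lemma clifford_ideal_add:
  assumes "a \<in> clifford_ideal p q" "b \<in> clifford_ideal p q"
  shows "(\<lambda>w. a w + b w) \<in> clifford_ideal p q"
  using additive_subgroup.a_closed[OF ideal.axioms(1)[OF ideal_clifford] assms] by simp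

lemma clifford_ideal_scale:
  assumes "a \<in> clifford_ideal p q"
  shows "(\<lambda>w. c * a w) \<in> clifford_ideal p q"
  using ideal.I_l_closed[OF ideal_clifford assms word_scalar_closed[of c]]
  by (simp add: word_mult_scalar_left)

lemma clifford_ideal_sum:
  assumes "finite S" "\<And>i. i \<in> S \<Longrightarrow> F i \<in> clifford_ideal p q"
  shows "(\<lambda>w. \<Sum>i\<in>S. F i w) \<in> clifford_ideal p q"
  using assms
proof (induction S)
  case empty
  show ?case
    using additive_subgroup.zero_closed[OF ideal.axioms(1)[OF ideal_clifford[of p q]]] by simp
qed (auto intro: clifford_ideal_add)

lemma free_vec_expand:
  assumes "v \<in> pseudo_space p q"
  shows "free_vec v = (\<lambda>w. \<Sum>i\<in>{1..p+q}. v i * free_vec (unit_vec i) w)"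
proof
  fix w
  have *: "v k = (\<Sum>i\<in>{1..p+q}. v i * unit_vec i k)" for k
  proof -
    have "(\<Sum>i\<in>{1..p+q}. v i * unit_vec i k) = (\<Sum>i\<in>{1..p+q}. if k = i then v k else 0)"
      by (intro sum.cong) (auto simp: unit_vec_def)
    then show ?thesis using assms by (auto simp: pseudo_space_def)
  qed
  show "free_vec v w = (\<Sum>i\<in>{1..p+q}. v i * free_vec (unit_vec i) w)"
    using *[of "hd w"] by (simp add: free_vec_def)
qed

lemma word_mult_sum:
  "word_mult (\<lambda>w. \<Sum>i\<in>S. c i * F i w) (\<lambda>w. \<Sum>j\<in>T. d j * G j w) w
    = (\<Sum>i\<in>S. \<Sum>j\<in>T. c i * d j * word_mult (F i) (G j) w)"
proof -
  have "word_mult (\<lambda>w. \<Sum>i\<in>S. c i * F i w) (\<lambda>w. \<Sum>j\<in>T. d j * G j w) w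
    = (\<Sum>k\<le>length w. \<Sum>i\<in>S. \<Sum>j\<in>T. c i * d j * (F i (take k w) * G j (drop k w)))"
    unfolding word_mult_def by (simp add: sum_product mult_ac)
  also have "\<dots> = (\<Sum>i\<in>S. \<Sum>k\<le>length w. \<Sum>j\<in>T. c i * d j * (F i (take k w) * G j (drop k w)))"
    by (rule sum.swap)
  also have "\<dots> = (\<Sum>i\<in>S. \<Sum>j\<in>T. \<Sum>k\<le>length w. c i * d j * (F i (take k w) * G j (drop k w)))"
    by (intro sum.cong refl sum.swap)
  finally show ?thesis by (simp add: word_mult_def sum_distrib_left)
qed

lemma pseudo_inner_unit:
  assumes "i \<in> {1..p+q}"
  shows "pseudo_inner p q (unit_vec i) (unit_vec j) = (if i = j then if i \<le> p then 1 else -1 else 0)"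
proof -
  have "unit_vec i k * unit_vec j k = (if k = i then if i = j then 1 else 0 else 0)" for k
    by (auto simp: unit_vec_def)
  then show ?thesis using assms by (simp add: pseudo_inner_def)
qed

lemma pseudo_inner_expand:
  "pseudo_inner p q a b =
    (\<Sum>i\<in>{1..p+q}. \<Sum>j\<in>{1..p+q}. a i * b j * pseudo_inner p q (unit_vec i) (unit_vec j))"
proof -
  have "(\<Sum>i\<in>{1..p+q}. \<Sum>j\<in>{1..p+q}. a i * b j * pseudo_inner p q (unit_vec i) (unit_vec j))
    = (\<Sum>i\<in>{1..p+q}. \<Sum>j\<in>{1..p+q}. if i = j then a i * b i * (if i \<le> p then 1 else -1) else 0)"
    by (intro sum.cong refl) (simp add: pseudo_inner_unit)
  also have "\<dots> = (\<Sum>i\<in>{1..p+q}. a i * b i * (if i \<le> p then 1 else -1))"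
    by simp
  also have "\<dots> = (\<Sum>i\<in>{1..p} \<union> {p+1..p+q}. a i * b i * (if i \<le> p then 1 else -1))"
    by (intro sum.cong) auto
  also have "\<dots> = (\<Sum>i\<in>{1..p}. a i * b i * (if i \<le> p then 1 else -1))
    + (\<Sum>i\<in>{p+1..p+q}. a i * b i * (if i \<le> p then 1 else -1))"
    by (rule sum.union_disjoint) auto
  also have "\<dots> = pseudo_inner p q a b"
    by (simp add: pseudo_inner_def sum_negf)
  finally show ?thesis ..
qed

lemma clifford_rel_unit:
  assumes "i \<in> {1..p+q}" "j \<in> {1..p+q}"
  shows "clifford_rel p q (unit_vec i) (unit_vec j) \<in> clifford_ideal p q"
proof -
  have gen: "r \<in> clifford_relators p q \<Longrightarrow> r \<in> clifford_ideal p q" for r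
    unfolding clifford_ideal_def
    using ring.genideal_self[OF ring_free_algebra clifford_relators_subset] by blast
  show ?thesis
  proof (cases "i = j")
    case True
    let ?r = "\<lambda>w. word_mult (free_vec (unit_vec i)) (free_vec (unit_vec i)) w
        + word_scalar (pseudo_inner p q (unit_vec i) (unit_vec i)) w"
    have "?r \<in> clifford_ideal p q"
      using assms by (intro gen) (auto simp: clifford_relators_def Let_def)
    \<comment> \<open>For equal indices both products coincide, so the polarized relation is twice
      the square relator.\<close>
    then have "(\<lambda>w. 2 * ?r w) \<in> clifford_ideal p q" by (rule clifford_ideal_scale)
    also have "(\<lambda>w. 2 * ?r w) = clifford_rel p q (unit_vec i) (unit_vec i)"
      by (auto simp: clifford_rel_def word_scalar_def)
    finally show ?thesis using True by simp
  next
    case False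
    then have "clifford_rel p q (unit_vec i) (unit_vec j) = (\<lambda>w.
        word_mult (free_vec (unit_vec i)) (free_vec (unit_vec j)) w
        + word_mult (free_vec (unit_vec j)) (free_vec (unit_vec i)) w)"
      using assms by (auto simp: clifford_rel_def pseudo_inner_unit word_scalar_def)
    also have "\<dots> \<in> clifford_ideal p q"
      using False assms by (intro gen) (auto simp: clifford_relators_def Let_def)
    finally show ?thesis .
  qed
qed

text \<open>The expression is bilinear in \<open>a\<close> and \<open>b\<close>, so it is a
  combination of the relations between basis vectors.\<close>

lemma clifford_rel_in_ideal:
  assumes a: "a \<in> pseudo_space p q" and b: "b \<in> pseudo_space p q"
  shows "clifford_rel p q a b \<in> clifford_ideal p q"
proof -
  let ?S = "{1..p+q}" and ?e = "\<lambda>i. free_vec (unit_vec i)"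
  have "clifford_rel p q a b w
    = (\<Sum>i\<in>?S. \<Sum>j\<in>?S. a i * b j * clifford_rel p q (unit_vec i) (unit_vec j) w)" for w
  proof -
    have "word_mult (free_vec a) (free_vec b) w = (\<Sum>i\<in>?S. \<Sum>j\<in>?S. a i * b j * word_mult (?e i) (?e j) w)"
      by (simp only: free_vec_expand[OF a] free_vec_expand[OF b] word_mult_sum)
    moreover have "word_mult (free_vec b) (free_vec a) w
        = (\<Sum>i\<in>?S. \<Sum>j\<in>?S. a i * b j * word_mult (?e j) (?e i) w)"
      unfolding free_vec_expand[OF a] free_vec_expand[OF b] word_mult_sum
      by (subst sum.swap) (simp only: mult_ac)
    moreover have "word_scalar (2 * pseudo_inner p q a b) w = (\<Sum>i\<in>?S. \<Sum>j\<in>?S.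
        a i * b j * word_scalar (2 * pseudo_inner p q (unit_vec i) (unit_vec j)) w)"
      by (subst pseudo_inner_expand) (simp add: word_scalar_def sum_distrib_left mult_ac)
    ultimately show ?thesis
      by (simp add: clifford_rel_def distrib_left sum.distrib)
  qed
  then have "clifford_rel p q a b
    = (\<lambda>w. \<Sum>i\<in>?S. \<Sum>j\<in>?S. a i * b j * clifford_rel p q (unit_vec i) (unit_vec j) w)"
    by (rule ext)
  also have "\<dots> \<in> clifford_ideal p q"
    by (intro clifford_ideal_sum clifford_ideal_scale clifford_rel_unit) auto
  finally show ?thesis .
qed


section \<open>Bilinearity of the inner product and of the product of words\<close>

lemma pseudo_inner_commute: "pseudo_inner p q a b = pseudo_inner p q b a"
  by (simp add: pseudo_inner_def mult.commute)

lemma pseudo_inner_add_left: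
  "pseudo_inner p q (\<lambda>k. a k + b k) c = pseudo_inner p q a c + pseudo_inner p q b c"
  by (simp add: pseudo_inner_def sum.distrib algebra_simps)

lemma pseudo_inner_diff_left:
  "pseudo_inner p q (\<lambda>k. a k - b k) c = pseudo_inner p q a c - pseudo_inner p q b c"
  by (simp add: pseudo_inner_def sum_subtractf algebra_simps)

lemma pseudo_inner_scale_left:
  "pseudo_inner p q (\<lambda>k. s * a k) c = s * pseudo_inner p q a c"
  by (simp add: pseudo_inner_def sum_distrib_left algebra_simps)

lemma word_mult_diff_left:
  "word_mult (\<lambda>w. a w - b w) c w = word_mult a c w - word_mult b c w"
  by (simp add: word_mult_def left_diff_distrib sum_subtractf)

lemma word_mult_diff_right:
  "word_mult c (\<lambda>w. a w - b w) w = word_mult c a w - word_mult c b w"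
  by (simp add: word_mult_def right_diff_distrib sum_subtractf)

text \<open>Shaped for the Moutard equation solved for the fourth vertex,
  \<open>d = a + s (c - b)\<close>.\<close>

lemma word_mult_free_vec_lin:
  "word_mult (free_vec (\<lambda>k. a k + s * (c k - b k))) x w
    = word_mult (free_vec a) x w + s * (word_mult (free_vec c) x w - word_mult (free_vec b) x w)"
proof -
  have "free_vec (\<lambda>k. a k + s * (c k - b k)) w
    = free_vec a w + s * (free_vec c w - free_vec b w)" for w
    by (simp add: free_vec_def)
  then show ?thesis
    unfolding word_mult_def by (simp only: distrib_right left_diff_distrib right_diff_distrib
        mult.assoc sum.distrib sum_subtractf sum_distrib_left)
qed

section \<open>Conditions in the quotient expressed by representatives\<close>

lemma clifford_coset_eq_iff:
  assumes "x \<in> carrier (free_algebra (p + q))" "y \<in> carrier (free_algebra (p + q))"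
  shows "clifford_ideal p q +>\<^bsub>free_algebra (p + q)\<^esub> x = clifford_ideal p q +>\<^bsub>free_algebra (p + q)\<^esub> y
    \<longleftrightarrow> (\<lambda>w. x w - y w) \<in> clifford_ideal p q"
  using ring.quotient_eq_iff_same_a_r_cos[OF ring_free_algebra ideal_clifford assms] assms
  by (simp add: a_minus_def free_algebra_uminus)

lemma clifford_ring_hom:
  "ring_hom_ring (free_algebra (p + q)) (clifford p q)
     ((+>\<^bsub>free_algebra (p + q)\<^esub>) (clifford_ideal p q))"
  unfolding clifford_def by (rule ideal.rcos_ring_hom_ring[OF ideal_clifford])

text \<open>Here \<open>a, b, c, d\<close> stand for the vertices
  \<open>f, f\<^sub>i, f\<^sub>j, f\<^sub>i\<^sub>j\<close> of a quadrilateral. The projection is a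
  ring homomorphism, so the additive condition becomes membership of one difference in the
  ideal.\<close>

lemma quad_sum_eq_iff:
  assumes V: "a \<in> pseudo_space p q" "b \<in> pseudo_space p q" "c \<in> pseudo_space p q" "d \<in> pseudo_space p q"
  shows "clifford_vec p q b \<otimes>\<^bsub>clifford p q\<^esub> clifford_vec p q a
      \<oplus>\<^bsub>clifford p q\<^esub> clifford_vec p q d \<otimes>\<^bsub>clifford p q\<^esub> clifford_vec p q b
    = clifford_vec p q c \<otimes>\<^bsub>clifford p q\<^esub> clifford_vec p q a
      \<oplus>\<^bsub>clifford p q\<^esub> clifford_vec p q d \<otimes>\<^bsub>clifford p q\<^esub> clifford_vec p q c
    \<longleftrightarrow> (\<lambda>w. (word_mult (free_vec b) (free_vec a) w + word_mult (free_vec d) (free_vec b) w)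
          - (word_mult (free_vec c) (free_vec a) w + word_mult (free_vec d) (free_vec c) w))
        \<in> clifford_ideal p q"
proof -
  interpret h: ring_hom_ring "free_algebra (p + q)" "clifford p q"
    "(+>\<^bsub>free_algebra (p + q)\<^esub>) (clifford_ideal p q)" by (rule clifford_ring_hom)
  note [simp] = free_vec_closed[OF V(1)] free_vec_closed[OF V(2)] free_vec_closed[OF V(3)]
    free_vec_closed[OF V(4)]
  show ?thesis
    unfolding clifford_vec_def
    by (simp add: h.hom_mult[symmetric] h.hom_add[symmetric] word_mult_closed word_add_closed
        clifford_coset_eq_iff del: h.hom_mult h.hom_add)
qed

text \<open>By associativity the inner factors are \<open>bb\<close> and \<open>cc\<close>, which
  reduce to the same scalar.\<close>

lemma quad_prod_eq:
  assumes V: "a \<in> pseudo_space p q" "b \<in> pseudo_space p q" "c \<in> pseudo_space p q" "d \<in> pseudo_space p q"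
    and bc: "pseudo_inner p q b b = pseudo_inner p q c c"
  shows "(clifford_vec p q d \<otimes>\<^bsub>clifford p q\<^esub> clifford_vec p q b)
      \<otimes>\<^bsub>clifford p q\<^esub> (clifford_vec p q b \<otimes>\<^bsub>clifford p q\<^esub> clifford_vec p q a)
    = (clifford_vec p q d \<otimes>\<^bsub>clifford p q\<^esub> clifford_vec p q c)
      \<otimes>\<^bsub>clifford p q\<^esub> (clifford_vec p q c \<otimes>\<^bsub>clifford p q\<^esub> clifford_vec p q a)"
proof -
  interpret h: ring_hom_ring "free_algebra (p + q)" "clifford p q"
    "(+>\<^bsub>free_algebra (p + q)\<^esub>) (clifford_ideal p q)" by (rule clifford_ring_hom)
  note [simp] = free_vec_closed[OF V(1)] free_vec_closed[OF V(2)] free_vec_closed[OF V(3)]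
    free_vec_closed[OF V(4)]
  let ?A = "free_vec a" and ?B = "free_vec b" and ?C = "free_vec c" and ?D = "free_vec d"
  \<comment> \<open>Half of \<open>clifford_rel p q b b\<close> is \<open>bb + <b,b>\<close>; the
    scalar parts cancel by \<open>bc\<close>.\<close>
  have "(\<lambda>w. word_mult ?B ?B w - word_mult ?C ?C w)
    = (\<lambda>w. 1/2 * clifford_rel p q b b w + (-1/2) * clifford_rel p q c c w)"
    by (rule ext) (simp add: clifford_rel_def bc algebra_simps)
  also have "\<dots> \<in> clifford_ideal p q"
    by (intro clifford_ideal_add clifford_ideal_scale clifford_rel_in_ideal V)
  finally have "word_mult ?D (word_mult (\<lambda>w. word_mult ?B ?B w - word_mult ?C ?C w) ?A)
      \<in> clifford_ideal p q"
    using ideal.I_l_closed[OF ideal_clifford ideal.I_r_closed[OF ideal_clifford, of _ p q ?A], of _ ?D]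
    by simp
  also have "word_mult ?D (word_mult (\<lambda>w. word_mult ?B ?B w - word_mult ?C ?C w) ?A)
    = (\<lambda>w. word_mult (word_mult ?D ?B) (word_mult ?B ?A) w
         - word_mult (word_mult ?D ?C) (word_mult ?C ?A) w)"
    by (simp add: word_mult_assoc word_mult_diff_left[abs_def] word_mult_diff_right[abs_def])
  finally show ?thesis
    unfolding clifford_vec_def
    by (simp add: h.hom_mult[symmetric] word_mult_closed clifford_coset_eq_iff del: h.hom_mult)
qed

section \<open>The two directions on a single quadrilateral\<close>

lemma moutard_quad_imp_sum:
  assumes V: "a \<in> pseudo_space p q" "b \<in> pseudo_space p q" "c \<in> pseudo_space p q"
    and d: "d = (\<lambda>k. a k + s * (c k - b k))" and "s \<noteq> 0"
    and \<kappa>: "pseudo_inner p q a a = \<kappa>" "pseudo_inner p q b b = \<kappa>" "pseudo_inner p q c c = \<kappa>"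
      "pseudo_inner p q d d = \<kappa>"
  shows "(\<lambda>w. (word_mult (free_vec b) (free_vec a) w + word_mult (free_vec d) (free_vec b) w)
          - (word_mult (free_vec c) (free_vec a) w + word_mult (free_vec d) (free_vec c) w))
        \<in> clifford_ideal p q" (is "?D \<in> _")
proof -
  let ?in = "pseudo_inner p q" and ?r = "clifford_rel p q"
  let ?x = "?in a b" and ?y = "?in a c" and ?z = "?in b c"
  have "?in d d = ?in a a + 2 * s * (?y - ?x) + s * s * (?in b b + ?in c c - 2 * ?z)"
    unfolding d pseudo_inner_add_left pseudo_inner_scale_left pseudo_inner_diff_left
      pseudo_inner_commute[of p q _ "\<lambda>k. a k + s * (c k - b k)"]
    by (simp add: pseudo_inner_commute[of p q b a] pseudo_inner_commute[of p q c a]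
        pseudo_inner_commute[of p q c b] algebra_simps)
  then have "s * (2 * (?y - ?x) + s * (2 * \<kappa> - 2 * ?z)) = 0"
    unfolding \<kappa> by (simp add: algebra_simps)
  \<comment> \<open>Equal norms of \<open>a\<close> and \<open>d\<close> leave a multiple of
    \<open>s\<close>; dividing by \<open>s\<close> gives the vanishing of the scalar part of the
    additive condition.\<close>
  with \<open>s \<noteq> 0\<close> have null: "2 * (?y - ?x) + s * (2 * \<kappa> - 2 * ?z) = 0" by simp
  have sc: "word_scalar t w = t * word_scalar 1 w" for t w
    by (simp add: word_scalar_def)
  \<comment> \<open>Substituting \<open>d = a + s (c - b)\<close> turns \<open>?D\<close> into
    \<open>(ab + ba) - (ac + ca) + s (bc + cb - bb - cc)\<close>. Each group is replaced by its
    relation; the halves arise because \<open>?r b b\<close> contains \<open>bb\<close> twice. The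
    leftover scalar is zero by \<open>null\<close>.\<close>
  have "?D w = (?r a b w + (-1) * ?r a c w)
      + (s * ?r b c w + ((-s/2) * ?r b b w + (-s/2) * ?r c c w))" for w
  proof -
    have "(?r a b w + (-1) * ?r a c w) + (s * ?r b c w + ((-s/2) * ?r b b w + (-s/2) * ?r c c w))
      - ?D w = - (2 * (?y - ?x) + s * (2 * \<kappa> - 2 * ?z)) * word_scalar 1 w"
      unfolding clifford_rel_def d word_mult_free_vec_lin \<kappa>(1-3) sc[of "2 * _"]
      by (simp add: field_simps)
    also have "\<dots> = 0" unfolding null by simp
    finally show ?thesis by linarith
  qed
  then have "?D = (\<lambda>w. (?r a b w + (-1) * ?r a c w)
      + (s * ?r b c w + ((-s/2) * ?r b b w + (-s/2) * ?r c c w)))" by (rule ext)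
  also have "\<dots> \<in> clifford_ideal p q"
    by (intro clifford_ideal_add clifford_ideal_scale clifford_rel_in_ideal V)
  finally show ?thesis .
qed

lemma sum_imp_moutard_quad:
  assumes V: "a \<in> pseudo_space p q" "b \<in> pseudo_space p q" "c \<in> pseudo_space p q" "d \<in> pseudo_space p q"
    and "c - b \<noteq> (\<lambda>_. 0)"
    and I: "(\<lambda>w. (word_mult (free_vec b) (free_vec a) w + word_mult (free_vec d) (free_vec b) w)
          - (word_mult (free_vec c) (free_vec a) w + word_mult (free_vec d) (free_vec c) w))
        \<in> clifford_ideal p q" (is "?D \<in> _")
  shows "\<exists>s. d - a = (\<lambda>k. s * (c - b) k)"
proof (rule parallel_if_wedge_zero)
  fix k l :: nat assume "k < l"
  let ?g = "\<lambda>A. if A = {k, l} then 1 else (0::real)"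
    and ?e = "\<lambda>k. - pseudo_inner p q (unit_vec k) (unit_vec k)"
  have wm: "word_mult (free_vec x) (free_vec y) \<in> carrier (free_algebra (p + q))"
    if "x \<in> pseudo_space p q" "y \<in> pseudo_space p q" for x y
    using that by (intro word_mult_closed free_vec_closed)
  have "finite {w. word_mult (free_vec b) (free_vec a) w + word_mult (free_vec d) (free_vec b) w \<noteq> 0}"
    "finite {w. word_mult (free_vec c) (free_vec a) w + word_mult (free_vec d) (free_vec c) w \<noteq> 0}"
    using V by (auto intro!: finite_support[OF word_add_closed] wm)
  from alg_op_diff[OF this, of ?e ?g "{}"] alg_op_clifford_ideal[OF I, of ?g "{}"]
  have "alg_op ?e (\<lambda>w. word_mult (free_vec b) (free_vec a) w + word_mult (free_vec d) (free_vec b) w) ?g {}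
    = alg_op ?e (\<lambda>w. word_mult (free_vec c) (free_vec a) w + word_mult (free_vec d) (free_vec c) w) ?g {}"
    by simp
  then have "(b l * a k - b k * a l) + (d l * b k - d k * b l)
    = (c l * a k - c k * a l) + (d l * c k - d k * c l)"
    using V \<open>k < l\<close> by (simp only: alg_op_add[OF wm wm] alg_op_wedge)
  \<comment> \<open>The equality of bivector coefficients rearranges to
    \<open>(d - a) \<and> (c - b) = 0\<close>, read as a wedge product.\<close>
  then show "(d - a) l * (c - b) k = (d - a) k * (c - b) l"
    by (simp add: algebra_simps)
qed fact

section \<open>From quadrilaterals to nets\<close>

lemma shift_lattice: "x \<in> lattice_pts n \<Longrightarrow> i \<in> {1..n} \<Longrightarrow> shift i x \<in> lattice_pts n"
  by (auto simp: lattice_pts_def shift_def)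

lemma shift_commute: "shift i (shift j x) = shift j (shift i x)"
  by (auto simp: shift_def fun_eq_iff)

lemma clifford_vec_closed:
  "v \<in> pseudo_space p q \<Longrightarrow> clifford_vec p q v \<in> carrier (clifford p q)"
  unfolding clifford_vec_def
  by (rule ring_hom_closed[OF ring_hom_ring.homh[OF clifford_ring_hom] free_vec_closed])

theorem proposition5p4:
  fixes n p q :: nat
    and f :: "(nat \<Rightarrow> int) \<Rightarrow> (nat \<Rightarrow> real)"
  assumes "f \<in> lattice_pts n \<rightarrow> pseudo_space p q"
    and "net_in_quadric n p q f"
    and "nonvanishing_diagonals n f"
  shows "moutard_net n f \<longleftrightarrow>
    parallelogram_net (clifford p q) n
      (\<lambda>i x. clifford_vec p q (f (shift i x)) \<otimes>\<^bsub>clifford p q\<^esub> clifford_vec p q (f x))"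
    (is "_ \<longleftrightarrow> parallelogram_net _ _ ?P")
proof -
  interpret R: ring "clifford p q" by (rule ring_clifford)
  obtain \<kappa> where \<kappa>: "pseudo_inner p q (f x) (f x) = \<kappa>" if "x \<in> lattice_pts n" for x
    using assms(2) unfolding net_in_quadric_def by blast
  have V: "f x \<in> pseudo_space p q" if "x \<in> lattice_pts n" for x
    using assms(1) that by blast
  \<comment> \<open>The equivalence holds face by face, with \<open>s\<close> in the role of the
    coefficient \<open>a i j x\<close>.\<close>
  have quad: "(\<exists>s. f (shift i (shift j x)) - f x = (\<lambda>k. s * (f (shift j x) - f (shift i x)) k)) \<longleftrightarrow>
      ?P i x \<oplus>\<^bsub>clifford p q\<^esub> ?P j (shift i x) = ?P j x \<oplus>\<^bsub>clifford p q\<^esub> ?P i (shift j x) \<and>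
      ?P j (shift i x) \<otimes>\<^bsub>clifford p q\<^esub> ?P i x = ?P i (shift j x) \<otimes>\<^bsub>clifford p q\<^esub> ?P j x"
    (is "?M \<longleftrightarrow> ?S \<and> ?T")
    if x: "x \<in> lattice_pts n" and ij: "1 \<le> i \<and> i < j \<and> j \<le> n" for x i j
  proof -
    have pts: "shift i x \<in> lattice_pts n" "shift j x \<in> lattice_pts n" "shift i (shift j x) \<in> lattice_pts n"
      using x ij by (auto intro!: shift_lattice)
    have diag: "f (shift i (shift j x)) - f x \<noteq> (\<lambda>_. 0)" "f (shift j x) - f (shift i x) \<noteq> (\<lambda>_. 0)"
      using assms(3) x ij unfolding nonvanishing_diagonals_def by blast+
    note sum_iff = quad_sum_eq_iff[OF V[OF x] V[OF pts(1)] V[OF pts(2)] V[OF pts(3)]]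
    have ?T
      \<comment> \<open>Both orders of shifting must name the same vertex
        \<open>f\<^sub>i\<^sub>j\<close>.\<close>
      unfolding shift_commute[of j i]
      by (rule quad_prod_eq) (use x pts V \<kappa> in simp_all)
    moreover have ?S if ?M
    proof -
      obtain s where s: "f (shift i (shift j x)) - f x = (\<lambda>k. s * (f (shift j x) - f (shift i x)) k)"
        using \<open>?M\<close> by blast
      \<comment> \<open>If \<open>s\<close> were zero, the diagonal
        \<open>f\<^sub>i\<^sub>j - f\<close> would vanish.\<close>
      with diag(1) have "s \<noteq> 0" by auto
      moreover have "f (shift i (shift j x)) = (\<lambda>k. f x k + s * (f (shift j x) k - f (shift i x) k))"
      proof
        fix k show "f (shift i (shift j x)) k = f x k + s * (f (shift j x) k - f (shift i x) k)"
          using fun_cong[OF s, of k] by simp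
      qed
      ultimately show ?thesis
        unfolding shift_commute[of j i] sum_iff
        using V \<kappa> x pts by (intro moutard_quad_imp_sum)
    qed
    \<comment> \<open>Here the other diagonal enters: \<open>f\<^sub>j - f\<^sub>i\<close> must be
      nonzero for the vanishing wedge to make \<open>f\<^sub>i\<^sub>j - f\<close> a multiple of
      it.\<close>
    moreover have ?M if ?S
      using \<open>?S\<close> diag(2) V x pts unfolding shift_commute[of j i] sum_iff
      by (intro sum_imp_moutard_quad)
    ultimately show ?thesis by blast
  qed
  have "?P i x \<in> carrier (clifford p q)" if "x \<in> lattice_pts n" "i \<in> {1..n}" for x i
    using that by (intro R.m_closed clifford_vec_closed V shift_lattice)
  moreover have "moutard_net n f \<longleftrightarrow> (\<forall>x\<in>lattice_pts n. \<forall>i j. 1 \<le> i \<and> i < j \<and> j \<le> n \<longrightarrow>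
      (\<exists>s. f (shift i (shift j x)) - f x = (\<lambda>k. s * (f (shift j x) - f (shift i x)) k)))"
  proof -
    define Q where "Q i j x s \<longleftrightarrow>
      f (shift i (shift j x)) - f x = (\<lambda>k. s * (f (shift j x) - f (shift i x)) k)" for i j x s
    \<comment> \<open>The coefficients found on the separate faces are gathered into one function by
      choice.\<close>
    have "\<exists>a. \<forall>x\<in>lattice_pts n. \<forall>i j. 1 \<le> i \<and> i < j \<and> j \<le> n \<longrightarrow> Q i j x (a i j x)"
      if "\<forall>x\<in>lattice_pts n. \<forall>i j. 1 \<le> i \<and> i < j \<and> j \<le> n \<longrightarrow> (\<exists>s. Q i j x s)"
      using that by (intro exI[of _ "\<lambda>i j x. SOME s. Q i j x s"] ballI allI impI) (metis someI_ex)
    then show ?thesis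
      unfolding moutard_net_def Q_def[symmetric] by blast
  qed
  moreover have "\<dots> \<longleftrightarrow> (\<forall>x\<in>lattice_pts n. \<forall>i j. 1 \<le> i \<and> i < j \<and> j \<le> n \<longrightarrow>
      ?P i x \<oplus>\<^bsub>clifford p q\<^esub> ?P j (shift i x) = ?P j x \<oplus>\<^bsub>clifford p q\<^esub> ?P i (shift j x) \<and>
      ?P j (shift i x) \<otimes>\<^bsub>clifford p q\<^esub> ?P i x = ?P i (shift j x) \<otimes>\<^bsub>clifford p q\<^esub> ?P j x)"
    by (intro ball_cong refl all_cong1 imp_cong) (rule quad)
  ultimately show ?thesis
    unfolding parallelogram_net_def by blast
qed

end
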